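(* For every natural number $n$ that is a power of a prime, there exists a geodetic Hamiltonian graph of diameter $2$ with $2n^2+2n+1$ vertices.
   Context: A geodesic is a shortest path between two vertices; a graph is geodetic if between any two of its vertices there is exactly one geodesic. A graph is Hamiltonian if it has a cycle through all its vertices. *)

theory Defs
  imports
    "HOL-Number_Theory.Prime_Powers"
    "Graph_Theory.Pair_Digraph"
    "Graph_Theory.Shortest_Path"
begin

text \<open>
  Graphs are symmetric digraphs, as in the library: every undirected edge is a pair of
  opposite arcs, and a path is given by its list of arcs. In a graph without parallel arcs
  a path is determined by its sequence of vertices, and the paths from \<open>v\<close> to \<open>u\<close> are the
  reversals of the paths from \<open>u\<close> to \<open>v\<close>.
\<close>

definition geodesic :: "('a, 'b) pre_digraph \<Rightarrow> 'a \<Rightarrow> 'b awalk \<Rightarrow> 'a \<Rightarrow> bool" where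
  "geodesic G u p v \<longleftrightarrow>
     pre_digraph.apath G u p v \<and> (\<forall>q. pre_digraph.apath G u q v \<longrightarrow> length p \<le> length q)"

definition geodetic :: "('a, 'b) pre_digraph \<Rightarrow> bool" where
  "geodetic G \<longleftrightarrow> (\<forall>u \<in> verts G. \<forall>v \<in> verts G. \<exists>!p. geodesic G u p v)"

text \<open>
  With unit weights \<open>\<mu>\<close> is the usual graph distance, which is \<open>\<infinity>\<close> between vertices in
  different components.
\<close>

definition diameter :: "('a, 'b) pre_digraph \<Rightarrow> ereal" where
  "diameter G = (SUP (u, v) \<in> verts G \<times> verts G. wf_digraph.\<mu> G (\<lambda>_. 1) u v)"

text \<open>
  In a symmetric digraph an arc followed by its opposite is a cycle in the sense of
  \<open>pre_digraph.cycle\<close>. The bound on the length excludes these, leaving exactly the cycles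
  of the undirected graph (when it is simple).
\<close>

definition hamiltonian :: "('a, 'b) pre_digraph \<Rightarrow> bool" where
  "hamiltonian G \<longleftrightarrow> (\<exists>p. pre_digraph.cycle G p \<and> 3 \<le> length p \<and> tail G ` set p = verts G)"

end

theory Submission
  imports
    Defs
    "HOL-Algebra.Algebraic_Closure"
    "HOL-Number_Theory.Residues"
begin

text \<open>
  Take a projective plane of order \<open>n\<close> with a line at infinity. The vertices are all points and
  all other lines. Edges join a point to the lines through it, any two points at infinity, and
  any two lines that meet at infinity. Two non-adjacent vertices then have exactly one common
  neighbour.

  For a prime power \<open>n\<close> the plane can be taken cyclic (Singer): there is a set \<open>D\<close> of residues
  modulo \<open>N = n\<^sup>2 + n + 1\<close> such that every nonzero residue is a difference of elements of \<open>D\<close> in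
  exactly one way, and point \<open>i\<close> lies on line \<open>j\<close> iff \<open>i + j \<in> D\<close>. If \<open>d\<close> and \<open>d + 1\<close> are in
  \<open>D\<close>, then the cyclic sequence of points \<open>i\<close> and lines \<open>d - i\<close>, taken alternately for
  \<open>i = 0, 1, 2, ...\<close>, runs through all points and lines. Replacing the line at infinity by an edge
  between its two neighbours leaves a Hamiltonian cycle.

  To obtain \<open>D\<close>, let \<open>g\<close> be a primitive element of the field \<open>K\<close> with \<open>n\<^sup>3\<close> elements, \<open>F\<close> its
  subfield with \<open>n\<close> elements, and \<open>W = F + F t\<close> for some \<open>t \<notin> F\<close>; then \<open>D\<close> is the set of
  exponents \<open>i < N\<close> with \<open>g\<^sup>i \<in> W\<close>. As \<open>n\<^sup>4 > n\<^sup>3\<close>, the map \<open>(x, y) \<mapsto> x - g\<^sup>e y\<close> on \<open>W \<times> W\<close>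
  is not injective, so \<open>g\<^sup>e\<close> is a quotient of nonzero elements of \<open>W\<close> and \<open>e\<close> is a difference of
  elements of \<open>D\<close>. Uniqueness follows by counting, because \<open>D\<close> has at most \<open>n + 1\<close> elements.
\<close>

section \<open>Graphs with unique common neighbours\<close>

lemma (in pair_graph) apath_conv:
  "apath u p v \<longleftrightarrow> u \<in> pverts G \<and> set p \<subseteq> parcs G \<and> pcas u p v \<and> distinct (pawalk_verts u p)"
  by (simp add: apath_def awalk_def)

text \<open>A path of length 2 is determined by its middle vertex, so a unique common neighbour
  means a unique geodesic; equal or adjacent vertices are joined by the only path of length 0 or
  1.\<close>

lemma geodetic_if_unique_common_neighbour:
  assumes G: "pair_graph G"
    and common: "\<And>u v. \<lbrakk>u \<in> pverts G; v \<in> pverts G; u \<noteq> v; (u, v) \<notin> parcs G\<rbrakk>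
      \<Longrightarrow> \<exists>!w. (u, w) \<in> parcs G \<and> (w, v) \<in> parcs G"
  shows "geodetic (with_proj G)"
proof -
  interpret pair_graph G by (fact G)
  have "\<exists>!p. geodesic (with_proj G) u p v" if uv: "u \<in> pverts G" "v \<in> pverts G" for u v
  proof -
    consider "u = v" | "u \<noteq> v" "(u, v) \<in> parcs G" | "u \<noteq> v" "(u, v) \<notin> parcs G" by blast
    then show ?thesis
    proof cases
      case 1
      then have "apath u [] v" using uv by (simp add: apath_conv)
      then show ?thesis unfolding geodesic_def by (intro ex1I[of _ "[]"]) auto
    next
      case 2
      then have p: "apath u [(u, v)] v" using uv by (simp add: apath_conv)
      have short: "q = [(u, v)] \<or> length q > 1" if "apath u q v" for q
        using that 2 by (cases q; cases "tl q") (auto simp: apath_conv)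
      show ?thesis unfolding geodesic_def
      proof (intro ex1I[of _ "[(u, v)]"] conjI allI impI)
        show "length [(u, v)] \<le> length q" if "apath u q v" for q
          using short[OF that] by auto
      next
        fix q assume "apath u q v \<and> (\<forall>r. apath u r v \<longrightarrow> length q \<le> length r)"
        then show "q = [(u, v)]" using short[of q] p by fastforce
      qed (fact p)
    next
      case 3
      from common[OF uv 3] obtain w where w: "(u, w) \<in> parcs G" "(w, v) \<in> parcs G"
        and uniq: "\<And>x. \<lbrakk>(u, x) \<in> parcs G; (x, v) \<in> parcs G\<rbrakk> \<Longrightarrow> x = w" by blast
      let ?p = "[(u, w), (w, v)]"
      have "u \<noteq> w" "w \<noteq> v" using w no_loops' by auto
      then have p: "apath u ?p v" using uv 3 w by (simp add: apath_conv)
      \<comment> \<open>Case \<open>3\<close> excludes lists of at most one arc; two arcs pass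
        through a common neighbour, so \<open>uniq\<close> leaves only \<open>?p\<close>.\<close>
      have short: "q = ?p \<or> length q > 2" if "apath u q v" for q
        using that 3 uniq by (cases q; cases "tl q"; cases "tl (tl q)") (auto simp: apath_conv)
      show ?thesis unfolding geodesic_def
      proof (intro ex1I[of _ ?p] conjI allI impI)
        show "length ?p \<le> length q" if "apath u q v" for q
          using short[OF that] by auto
      next
        fix q assume "apath u q v \<and> (\<forall>r. apath u r v \<longrightarrow> length q \<le> length r)"
        then show "q = ?p" using short[of q] p by fastforce
      qed (fact p)
    qed
  qed
  then show ?thesis by (simp add: geodetic_def)
qed

text \<open>\<open>\<mu>\<close> is an infimum over walks: one walk of at most two arcs bounds it
  from above, while \<open>a\<close> and \<open>b\<close> admit no walk of fewer than two
  arcs.\<close>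

lemma diameter_eq_2:
  assumes G: "pair_graph G"
    and common: "\<And>u v. \<lbrakk>u \<in> pverts G; v \<in> pverts G; u \<noteq> v; (u, v) \<notin> parcs G\<rbrakk>
      \<Longrightarrow> \<exists>w. (u, w) \<in> parcs G \<and> (w, v) \<in> parcs G"
    and far: "a \<in> pverts G" "b \<in> pverts G" "a \<noteq> b" "(a, b) \<notin> parcs G"
  shows "diameter (with_proj G) = 2"
proof -
  interpret pair_graph G by (fact G)
  have cost: "awalk_cost (\<lambda>_. 1) p = real (length p)" for p :: "('a \<times> 'a) awalk"
    by (induction p) auto
  have le: "\<mu> (\<lambda>_. 1) u v \<le> 2" if uv: "u \<in> pverts G" "v \<in> pverts G" for u v
  proof -
    have "\<exists>p. awalk u p v \<and> length p \<le> 2"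
    proof -
      consider "u = v" | "(u, v) \<in> parcs G" | w where "(u, w) \<in> parcs G" "(w, v) \<in> parcs G"
        using common[OF uv] by blast
      then show ?thesis
      proof cases
        case 1
        then show ?thesis using uv by (intro exI[of _ "[]"]) (simp add: awalk_def)
      next
        case 2
        then show ?thesis using uv by (intro exI[of _ "[(u, v)]"]) (simp add: awalk_def)
      next
        case 3
        then show ?thesis using uv by (intro exI[of _ "[(u, w), (w, v)]"]) (simp add: awalk_def)
      qed
    qed
    then obtain p where p: "awalk u p v" "length p \<le> 2" by blast
    have "\<mu> (\<lambda>_. 1) u v \<le> ereal (real (length p))"
      using min_cost_le_walk_cost[OF p(1), of "\<lambda>_. 1"] by (simp add: cost)
    also have "\<dots> \<le> ereal 2" using p(2) by simp
    finally show ?thesis by simp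
  qed
  have ge: "2 \<le> \<mu> (\<lambda>_. 1) a b"
    unfolding \<mu>_def
  proof (rule INF_greatest)
    fix p assume "p \<in> {p. awalk a p b}"
    then have "length p \<ge> 2" using far
      by (cases p; cases "tl p") (auto simp: awalk_def)
    then show "2 \<le> ereal (awalk_cost (\<lambda>_. 1) p)" by (simp add: cost)
  qed
  show ?thesis unfolding diameter_def
    by (rule antisym[OF SUP_least SUP_upper2[of "(a, b)"]]) (use le ge far in auto)
qed

text \<open>Passes from a cyclic list of vertices to the library's cycles, which are lists of
  arcs.\<close>

lemma hamiltonian_if_cyclic_enumeration:
  assumes G: "pair_graph G"
    and m: "3 \<le> m"
    and inj: "inj_on f {..<m}" and range: "f ` {..<m} = pverts G"
    and step: "\<And>k. Suc k < m \<Longrightarrow> (f k, f (Suc k)) \<in> parcs G"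
    and closing: "(f (m - 1), f 0) \<in> parcs G"
  shows "hamiltonian (with_proj G)"
proof -
  interpret pair_graph G by (fact G)
  \<comment> \<open>\<open>r k\<close> is the final stretch of the cycle, from \<open>f k\<close> up
    to \<open>f (m - 1)\<close> and back to \<open>f 0\<close>. Varying \<open>k\<close> permits an
    induction downwards from \<open>m - 1\<close>; only \<open>r 0\<close> is wanted.\<close>
  define r where "r k = map (\<lambda>i. (f i, f (Suc i))) [k..<m - 1] @ [(f (m - 1), f 0)]" for k
  have r_step: "r k = (f k, f (Suc k)) # r (Suc k)" if "k < m - 1" for k
    using that by (simp add: r_def upt_conv_Cons)
  have r_last: "r (m - 1) = [(f (m - 1), f 0)]" by (simp add: r_def)
  have walk: "pcas (f k) (r k) (f 0) \<and> pawalk_verts (f k) (r k) = map f [k..<m] @ [f 0]"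
    if "k \<le> m - 1" for k
    using that
  proof (induction k rule: inc_induct)
    case base
    have "[m - 1..<m] = [m - 1]" using m upt_rec[of "m - 1" m] by simp
    then show ?case by (simp add: r_last del: One_nat_def)
  next
    case (step k)
    then have "[k..<m] = k # [Suc k..<m]" by (simp add: upt_conv_Cons)
    with step show ?case by (simp add: r_step)
  qed
  have arcs: "set (r 0) \<subseteq> parcs G"
    using step closing by (auto simp: r_def)
  \<comment> \<open>\<open>cycle\<close> demands distinctness of the vertex list without its head,
    because the first vertex recurs at the end.\<close>
  have "map f [0..<m] = f 0 # map f [1..<m]" using m by (simp add: upt_conv_Cons)
  then have "tl (pawalk_verts (f 0) (r 0)) = map f [1..<m] @ [f 0]"
    using walk[of 0] by simp
  moreover have "distinct (map f [1..<m] @ [f 0])"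
    using inj m by (fastforce simp: distinct_map inj_on_def)
  ultimately have "cycle (r 0)"
    unfolding cycle_def using walk[of 0] arcs range m
    by (intro exI[of _ "f 0"]) (auto simp: awalk_def r_def)
  moreover have "3 \<le> length (r 0)" using m by (simp add: r_def)
  moreover have "fst ` set (r 0) = pverts G"
  proof -
    have "fst ` set (r 0) = f ` insert (m - 1) {0..<m - 1}"
      by (auto simp: r_def image_image)
    also have "insert (m - 1) {0..<m - 1} = {..<m}" using m by auto
    finally show ?thesis using range by simp
  qed
  ultimately show ?thesis unfolding hamiltonian_def by auto
qed

section \<open>Finite fields\<close>

lemma (in cring) binomial:
  assumes [simp]: "x \<in> carrier R" "y \<in> carrier R"
  shows "(x \<oplus> y) [^] n = (\<Oplus>k\<in>{..n}. [(n choose k)] \<cdot> (x [^] k \<otimes> y [^] (n - k)))"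
proof (induction n)
  case 0
  then show ?case by simp
next
  case (Suc n)
  define t where "t k = [(n choose k)] \<cdot> (x [^] k \<otimes> y [^] (n - k))" for k
  define u where "u k = [(n choose k)] \<cdot> (x [^] k \<otimes> y [^] (Suc n - k))" for k
  have t: "t k \<in> carrier R" and u: "u k \<in> carrier R" for k
    by (simp_all add: t_def u_def)
  have tx: "[(n choose k)] \<cdot> (x [^] Suc k \<otimes> y [^] (n - k)) = t k \<otimes> x" for k
    by (simp add: t_def add_pow_rdistr m_ac)
  have ty: "u k = t k \<otimes> y" if "k \<le> n" for k
    using that by (simp add: t_def u_def add_pow_rdistr m_ac Suc_diff_le)
  \<comment> \<open>Pascal's rule: \<open>x\<close> times term \<open>k\<close> and \<open>y\<close>
    times term \<open>Suc k\<close> share a monomial. The summand \<open>u (Suc n)\<close> has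
    coefficient 0 and is dropped below.\<close>
  have pascal: "[(Suc n choose Suc k)] \<cdot> (x [^] Suc k \<otimes> y [^] (Suc n - Suc k)) = t k \<otimes> x \<oplus> u (Suc k)" for k
    unfolding tx[symmetric] u_def binomial_Suc_Suc by (simp add: add.nat_pow_mult del: nat_pow_Suc)
  have "(\<Oplus>k\<in>{..Suc n}. [(Suc n choose k)] \<cdot> (x [^] k \<otimes> y [^] (Suc n - k)))
      = (\<Oplus>k\<in>{..n}. t k \<otimes> x \<oplus> u (Suc k)) \<oplus> u 0"
    unfolding pascal[symmetric] by (subst finsum_Suc2) (auto simp: u_def)
  also have "\<dots> = (\<Oplus>k\<in>{..n}. t k \<otimes> x) \<oplus> ((\<Oplus>k\<in>{..n}. u (Suc k)) \<oplus> u 0)"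
    using t u by (subst finsum_addf) (auto simp: a_assoc)
  also have "(\<Oplus>k\<in>{..n}. u (Suc k)) \<oplus> u 0 = (\<Oplus>k\<in>{..Suc n}. u k)"
    using u by (subst finsum_Suc2) auto
  also have "\<dots> = (\<Oplus>k\<in>{..n}. u k)"
    using u by (subst finsum_Suc) (auto simp: u_def binomial_eq_0)
  also have "\<dots> = (\<Oplus>k\<in>{..n}. t k \<otimes> y)"
    using t by (intro finsum_cong') (auto simp: ty)
  also have "(\<Oplus>k\<in>{..n}. t k \<otimes> x) = (\<Oplus>k\<in>{..n}. t k) \<otimes> x"
    using t by (subst finsum_ldistr) auto
  also have "(\<Oplus>k\<in>{..n}. t k \<otimes> y) = (\<Oplus>k\<in>{..n}. t k) \<otimes> y"
    using t by (subst finsum_ldistr) auto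
  also have "(\<Oplus>k\<in>{..n}. t k) = (x \<oplus> y) [^] n"
    using Suc by (simp add: t_def)
  also have "(x \<oplus> y) [^] n \<otimes> x \<oplus> (x \<oplus> y) [^] n \<otimes> y = (x \<oplus> y) [^] Suc n"
    by (simp add: r_distr)
  finally show ?case by simp
qed

text \<open>For \<open>0 < k < p\<close> the coefficient \<open>p choose k\<close> is divisible by
  \<open>p\<close> and kills its term; induction on \<open>m\<close> iterates the case of exponent
  \<open>p\<close>.\<close>

lemma (in cring) frobenius_add:
  assumes p: "Factorial_Ring.prime (p :: nat)" and char: "[p] \<cdot> \<one> = \<zero>"
    and [simp]: "x \<in> carrier R" "y \<in> carrier R"
  shows "(x \<oplus> y) [^] (p ^ m) = x [^] (p ^ m) \<oplus> y [^] (p ^ m)"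
proof (induction m)
  case 0
  then show ?case by simp
next
  case (Suc m)
  have multiple: "[c] \<cdot> z = \<zero>" if "p dvd c" "z \<in> carrier R" for c z
  proof -
    have "[p] \<cdot> z = ([p] \<cdot> \<one>) \<otimes> z" using that(2) by (subst add_pow_ldistr) auto
    then have "[p] \<cdot> z = \<zero>" using char that by simp
    with that show ?thesis by (auto elim!: dvdE simp: add.nat_pow_pow[symmetric])
  qed
  have *: "(a \<oplus> b) [^] p = a [^] p \<oplus> b [^] p" if [simp]: "a \<in> carrier R" "b \<in> carrier R" for a b
  proof -
    have "p > 0" using p prime_gt_0_nat by blast
    have "(a \<oplus> b) [^] p = (\<Oplus>k\<in>{..p}. [(p choose k)] \<cdot> (a [^] k \<otimes> b [^] (p - k)))"
      by (rule binomial) simp_all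
    also have "\<dots> = (\<Oplus>k\<in>{0, p}. [(p choose k)] \<cdot> (a [^] k \<otimes> b [^] (p - k)))"
      by (intro add.finprod_mono_neutral_cong_right) (auto intro!: multiple dvd_choose_prime p)
    also have "\<dots> = a [^] p \<oplus> b [^] p"
      using \<open>p > 0\<close> by (simp add: a_comm)
    finally show ?thesis .
  qed
  have "z [^] (p ^ Suc m) = (z [^] (p ^ m)) [^] p" if "z \<in> carrier R" for z
    using that by (simp add: nat_pow_pow mult.commute)
  then show ?case using Suc by (simp add: *)
qed

text \<open>Carries the equation \<open>[p] \<cdot> \<one> = \<zero>\<close> from a ring to its
  polynomial ring, and from the residues modulo \<open>p\<close> to their algebraic closure.\<close>

lemma ring_hom_add_pow_one:
  assumes "ring R" "ring S" "h \<in> ring_hom R S"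
  shows "h ([(n :: nat)] \<cdot>\<^bsub>R\<^esub> \<one>\<^bsub>R\<^esub>) = [n] \<cdot>\<^bsub>S\<^esub> \<one>\<^bsub>S\<^esub>"
proof -
  interpret R: ring R by fact
  interpret S: ring S by fact
  interpret ring_hom_ring R S h by (rule ring_hom_ringI2) fact+
  show ?thesis by (induction n) auto
qed

text \<open>Sums are preserved by \<open>frobenius_add\<close>, products by commutativity. Used
  first to cut a finite field out of an algebraic closure, later for the subfield \<open>F\<close>
  of that field.\<close>

lemma (in field) subfield_frobenius_fixed:
  assumes p: "Factorial_Ring.prime (p :: nat)" and char: "[p] \<cdot> \<one> = \<zero>"
  shows "subfield {x \<in> carrier R. x [^] (p ^ m) = x} R" (is "subfield ?F R")
proof (rule subfieldI')
  have q: "p ^ m > 0" using p prime_gt_0_nat by simp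
  note frob = frobenius_add[OF p char]
  show "subring ?F R"
  proof (rule subringI)
    fix x assume x: "x \<in> ?F"
    \<comment> \<open>Expanding a power of \<open>x \<oplus> \<ominus> x\<close>, which is zero,
      avoids separating even and odd exponents.\<close>
    have "x \<oplus> (\<ominus> x) [^] (p ^ m) = (x \<oplus> \<ominus> x) [^] (p ^ m)"
      using frob[of x "\<ominus> x" m] x by simp
    also have "\<dots> = \<zero>" using x q by (simp add: r_neg nat_pow_zero)
    finally show "\<ominus> x \<in> ?F" using x by (simp add: sum_zero_eq_neg a_comm)
  next
    fix x y assume "x \<in> ?F" "y \<in> ?F"
    then show "x \<otimes> y \<in> ?F" "x \<oplus> y \<in> ?F" by (auto simp: frob nat_pow_distrib)
  qed auto
next
  fix x assume x: "x \<in> ?F - {\<zero>}"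
  then have u: "x \<in> Units R" by (simp add: field_Units)
  have "(inv x) [^] (p ^ m) \<otimes> x [^] (p ^ m) = (inv x \<otimes> x) [^] (p ^ m)"
    using x Units_inv_closed[OF u] by (subst nat_pow_distrib) simp_all
  also have "\<dots> = \<one>" using u by simp
  finally have "(inv x) [^] (p ^ m) \<otimes> x [^] (p ^ m) = \<one>" .
  moreover have "x [^] (p ^ m) = x" using x by simp
  ultimately have "(inv x) [^] (p ^ m) \<otimes> x = \<one>" by metis
  then have "inv x = (inv x) [^] (p ^ m)" using x u by (intro comm_inv_char) (auto simp: m_comm)
  then show "inv x \<in> ?F" using u by simp
qed

section \<open>Simple roots of \<open>X^q - X\<close> and the size of the fixed field\<close>

context algebraically_closed
begin

text \<open>
  The Frobenius map of the polynomial ring gives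
  \<open>X\<^sup>q - X = (X - a)\<^sup>q - (X - a) = (X - a) ((X - a)\<^sup>q\<^sup>-\<^sup>1 - 1)\<close>, and the second factor
  does not vanish at \<open>a\<close>. This replaces the usual derivative argument.
\<close>

lemma alg_mult_frobenius_fixed_le_1:
  assumes p: "Factorial_Ring.prime (p :: nat)" and char: "[p] \<cdot> \<one> = \<zero>" and m: "m > 0"
    and Q: "Q = X [^]\<^bsub>poly_ring L\<^esub> (p ^ m) \<ominus>\<^bsub>poly_ring L\<^esub> X"
    and a: "a \<in> carrier L" "a [^] (p ^ m) = a"
  shows "alg_mult Q a \<le> 1"
proof (rule ccontr)
  assume "\<not> alg_mult Q a \<le> 1"
  interpret UP: domain "poly_ring L" by (rule univ_poly_is_domain[OF carrier_is_subring])
  interpret const: ring_hom_ring L "poly_ring L" poly_of_const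
    using canonical_embedding_ring_hom[OF carrier_is_subring] by simp
  interpret ev: ring_hom_ring "poly_ring L" L "\<lambda>f. eval f a"
    by (rule eval_ring_hom[OF carrier_is_subring a(1)])
  let ?q = "p ^ m"
  have q: "?q \<ge> 2"
    using prime_ge_2_nat[OF p] self_le_power[of p m] m by linarith
  have [simp]: "X \<in> carrier (poly_ring L)" by (rule var_closed[OF carrier_is_subring])
  have charP: "[p] \<cdot>\<^bsub>poly_ring L\<^esub> \<one>\<^bsub>poly_ring L\<^esub> = \<zero>\<^bsub>poly_ring L\<^esub>"
    using ring_hom_add_pow_one[OF ring_axioms UP.ring_axioms const.homh, of p] char by simp
  \<comment> \<open>Since \<open>b\<close> is also fixed, raising \<open>c\<close> to the power
    \<open>?q\<close> leaves it unchanged. Hence \<open>l = X + c\<close> has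
    \<open>l^q = X^q + c\<close>, and the constant cancels in \<open>l^q - l = Q\<close>.\<close>
  define b where "b = \<ominus> a"
  have b: "b \<in> carrier L" "b [^] ?q = b"
    using subringE(5)[OF subfieldE(1)[OF subfield_frobenius_fixed[OF p char, of m]], of a] a
    by (simp_all add: b_def)
  define c where "c = poly_of_const b"
  have c: "c \<in> carrier (poly_ring L)" using b by (simp add: c_def)
  have cq: "c [^]\<^bsub>poly_ring L\<^esub> ?q = c"
    unfolding c_def using b const.hom_nat_pow[of b ?q] by simp
  define l where "l = [\<one>, \<ominus> a]"
  have l_eq: "l = X \<oplus>\<^bsub>poly_ring L\<^esub> c"
    using b unfolding l_def b_def[symmetric] c_def var_def poly_of_const_def univ_poly_add
    by (auto)
  have l: "l \<in> carrier (poly_ring L)" using c by (simp add: l_eq)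
  have lq: "l [^]\<^bsub>poly_ring L\<^esub> ?q = X [^]\<^bsub>poly_ring L\<^esub> ?q \<oplus>\<^bsub>poly_ring L\<^esub> c"
    unfolding l_eq using UP.frobenius_add[OF p charP _ c, of X m] cq by simp
  have lq': "l [^]\<^bsub>poly_ring L\<^esub> ?q = l \<otimes>\<^bsub>poly_ring L\<^esub> l [^]\<^bsub>poly_ring L\<^esub> (?q - 1)"
  proof -
    have "Suc (?q - 1) = ?q" using q by linarith
    then show ?thesis using UP.nat_pow_Suc2[OF l, of "?q - 1"] by metis
  qed
  have Q_eq: "Q = l \<otimes>\<^bsub>poly_ring L\<^esub> (l [^]\<^bsub>poly_ring L\<^esub> (?q - 1) \<ominus>\<^bsub>poly_ring L\<^esub> \<one>\<^bsub>poly_ring L\<^esub>)"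
  proof -
    have "Q = l [^]\<^bsub>poly_ring L\<^esub> ?q \<ominus>\<^bsub>poly_ring L\<^esub> l"
      unfolding Q lq unfolding l_eq using c by (simp add: UP.minus_eq UP.minus_add UP.a_ac UP.r_neg1 UP.r_neg2)
    then show ?thesis unfolding lq' using l by (simp add: UP.minus_eq UP.r_distr UP.r_minus)
  qed
  \<comment> \<open>Multiplicity at least 2 would leave a factor \<open>l\<close> after cancelling
    one; then \<open>l^(q-1) - 1\<close> would vanish at \<open>a\<close>, where its value is
    \<open>-1\<close>.\<close>
  have "(l [^]\<^bsub>poly_ring L\<^esub> (2 :: nat)) pdivides Q"
    unfolding l_def using \<open>\<not> alg_mult Q a \<le> 1\<close>
    by (intro le_alg_mult_imp_pdivides) (use a in \<open>auto simp: Q\<close>)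
  then obtain r where r: "r \<in> carrier (poly_ring L)"
    and "Q = (l [^]\<^bsub>poly_ring L\<^esub> (2 :: nat)) \<otimes>\<^bsub>poly_ring L\<^esub> r"
    unfolding pdivides_def factor_def by auto
  then have "Q = l \<otimes>\<^bsub>poly_ring L\<^esub> (l \<otimes>\<^bsub>poly_ring L\<^esub> r)"
    using l by (simp add: numeral_2_eq_2 UP.m_assoc)
  moreover have "l \<noteq> \<zero>\<^bsub>poly_ring L\<^esub>" by (simp add: l_def univ_poly_zero)
  ultimately have eq: "l \<otimes>\<^bsub>poly_ring L\<^esub> r = l [^]\<^bsub>poly_ring L\<^esub> (?q - 1) \<ominus>\<^bsub>poly_ring L\<^esub> \<one>\<^bsub>poly_ring L\<^esub>"
    using Q_eq UP.m_lcancel[of l] l r by simp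
  have la: "eval l a = \<zero>" using a by (simp add: l_def r_neg)
  have "\<zero> = eval (l \<otimes>\<^bsub>poly_ring L\<^esub> r) a"
    using l r la by (simp add: ev.hom_mult)
  also have "\<dots> = \<zero> [^] (?q - 1) \<oplus> \<ominus> \<one>"
    unfolding eq UP.minus_eq la[symmetric] using l by (simp add: ev.hom_add ev.hom_nat_pow ev.hom_a_inv)
  also have "\<zero> [^] (?q - 1) = \<zero>" by (rule nat_pow_zero) (use q in linarith)
  also have "\<zero> \<oplus> \<ominus> \<one> = \<ominus> \<one>" by simp
  finally show False by (metis add.inv_eq_1_iff one_closed one_not_zero)
qed

text \<open>The fixed elements are the roots of \<open>X^q - X\<close>, which splits over
  \<open>L\<close> into \<open>?q\<close> roots counted with multiplicity, and all multiplicities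
  are 1.\<close>

lemma card_frobenius_fixed:
  assumes p: "Factorial_Ring.prime (p :: nat)" and char: "[p] \<cdot> \<one> = \<zero>" and m: "m > 0"
  shows "card {x \<in> carrier L. x [^] (p ^ m) = x} = p ^ m" (is "card ?F = ?q")
proof -
  interpret UP: domain "poly_ring L" by (rule univ_poly_is_domain[OF carrier_is_subring])
  have q: "?q \<ge> 2"
    using prime_ge_2_nat[OF p] self_le_power[of p m] m by linarith
  have X: "X \<in> carrier (poly_ring L)" by (rule var_closed[OF carrier_is_subring])
  define Q where "Q = X [^]\<^bsub>poly_ring L\<^esub> ?q \<ominus>\<^bsub>poly_ring L\<^esub> X"
  have Q: "Q \<in> carrier (poly_ring L)" using X by (simp add: Q_def)
  have degXq: "degree (X [^]\<^bsub>poly_ring L\<^esub> ?q) = ?q"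
    by (simp add: unitary_monom_eq_var_pow[OF carrier_is_subring, symmetric] monom_def)
  have degX: "degree (\<ominus>\<^bsub>poly_ring L\<^esub> X) = 1"
    using univ_poly_a_inv_degree[OF carrier_is_subring X] by (simp add: var_def)
  have deg: "degree Q = ?q"
  proof -
    have "degree Q = max (degree (X [^]\<^bsub>poly_ring L\<^esub> ?q)) (degree (\<ominus>\<^bsub>poly_ring L\<^esub> X))"
      unfolding Q_def UP.minus_eq univ_poly_add
    proof (rule poly_add_degree_eq[OF carrier_is_subring])
      show "degree (X [^]\<^bsub>poly_ring L\<^esub> ?q) \<noteq> degree (\<ominus>\<^bsub>poly_ring L\<^esub> X)"
        unfolding degXq degX using q by linarith
    qed (use X in \<open>simp_all add: univ_poly_carrier\<close>)
    then show ?thesis unfolding degXq degX using q by linarith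
  qed
  have root: "is_root Q x \<longleftrightarrow> x \<in> ?F" for x
  proof (cases "x \<in> carrier L")
    case True
    interpret ev: ring_hom_ring "poly_ring L" L "\<lambda>f. eval f x"
      by (rule eval_ring_hom[OF carrier_is_subring True])
    have "eval Q x = x [^] ?q \<ominus> x"
      unfolding Q_def UP.minus_eq minus_eq using X
      by (simp add: ev.hom_add ev.hom_nat_pow ev.hom_a_inv eval_var True)
    moreover have "Q \<noteq> []"
    proof
      assume "Q = []"
      then have "?q = 0" using deg by simp
      then show False using q by linarith
    qed
    ultimately show ?thesis using True by (simp add: is_root_def)
  qed (simp add: is_root_def)
  have "count (roots Q) x = (if x \<in> ?F then 1 else 0)" for x
  proof -
    have "count (roots Q) x = alg_mult Q x"
      using alg_mult_eq_count_roots[OF Q] by simp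
    moreover have "alg_mult Q x > 0 \<longleftrightarrow> x \<in> ?F"
      using alg_mult_gt_zero_iff_is_root[OF Q] root by simp
    moreover have "alg_mult Q x \<le> 1" if "x \<in> ?F"
      using alg_mult_frobenius_fixed_le_1[OF p char m Q_def] that by simp
    ultimately show ?thesis by auto
  qed
  moreover have "set_mset (roots Q) = ?F"
    using roots_mem_iff_is_root[OF Q] root by auto
  ultimately have "size (roots Q) = card ?F"
    by (simp add: size_multiset_overloaded_eq)
  moreover have "size (roots Q) = ?q"
    using roots_over_carrier[OF Q] deg by (simp add: splitted_def)
  ultimately show ?thesis by simp
qed

end

text \<open>The fixed field of a Frobenius power in an algebraic closure of the residues modulo
  \<open>p\<close>, hence the carrier type. The third property allows Frobenius to be applied again
  within \<open>K\<close>.\<close>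

lemma finite_field_exists:
  assumes p: "Factorial_Ring.prime (p :: nat)" and m: "m > 0"
  obtains K :: "((int list \<times> nat) multiset \<Rightarrow> int) ring"
    where "field K" "card (carrier K) = p ^ m" "[p] \<cdot>\<^bsub>K\<^esub> \<one>\<^bsub>K\<^esub> = \<zero>\<^bsub>K\<^esub>"
proof -
  define Z where "Z = residue_ring (int p)"
  interpret Z: residues_prime p Z by unfold_locales (auto simp: p Z_def)
  obtain L :: "((int list \<times> nat) multiset \<Rightarrow> int) ring"
    where L: "algebraic_closure L (Z.indexed_const ` carrier Z)"
      and hom: "Z.indexed_const \<in> ring_hom Z L"
    by (rule Z.exists_closure)
  interpret L: algebraic_closure L "Z.indexed_const ` carrier Z" by (fact L)
  have Z: "[k] \<cdot>\<^bsub>Z\<^esub> \<one>\<^bsub>Z\<^esub> = int k mod int p" for k :: nat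
    by (induction k) (auto simp: Z.res_zero_eq Z.res_add_eq Z.res_one_eq mod_simps ac_simps)
  have char: "[p] \<cdot>\<^bsub>L\<^esub> \<one>\<^bsub>L\<^esub> = \<zero>\<^bsub>L\<^esub>"
    using ring_hom_add_pow_one[OF Z.ring_axioms L.ring_axioms hom, of p]
      ring_hom_zero[OF hom Z.ring_axioms L.ring_axioms] Z[of p] by (simp add: Z.res_zero_eq)
  let ?F = "{x \<in> carrier L. x [^]\<^bsub>L\<^esub> (p ^ m) = x}"
  show thesis
  proof (rule that[of "L\<lparr>carrier := ?F\<rparr>"])
    show "field (L\<lparr>carrier := ?F\<rparr>)"
      by (rule L.subfield_iff(2)[OF L.subfield_frobenius_fixed[OF p char]])
    show "card (carrier (L\<lparr>carrier := ?F\<rparr>)) = p ^ m"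
      using L.card_frobenius_fixed[OF p char m] by simp
    show "[p] \<cdot>\<^bsub>L\<lparr>carrier := ?F\<rparr>\<^esub> \<one>\<^bsub>L\<lparr>carrier := ?F\<rparr>\<^esub> = \<zero>\<^bsub>L\<lparr>carrier := ?F\<rparr>\<^esub>"
      using char by (simp add: add_pow_def nat_pow_def)
  qed
qed

section \<open>Singer difference sets\<close>

text \<open>The element \<open>a\<close> determines its partner \<open>(a + d) mod N\<close>, so a
  unique \<open>a\<close> means a unique representation of \<open>d\<close> as a difference.\<close>

definition perfect_difference_set :: "nat \<Rightarrow> nat set \<Rightarrow> bool" where
  "perfect_difference_set N D \<longleftrightarrow>
     D \<subseteq> {..<N} \<and> (\<forall>d. 0 < d \<and> d < N \<longrightarrow> (\<exists>!a. a \<in> D \<and> (a + d) mod N \<in> D))"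

lemma add_mod_cancel_left:
  fixes a d e N :: nat
  assumes "(a + d) mod N = (a + e) mod N" "d < N" "e < N"
  shows "d = e"
  using assms by (metis cong_def cong_add_lcancel_nat mod_less)

text \<open>There are at most \<open>(q + 1) * q = N - 1\<close> ordered pairs of distinct elements,
  and all \<open>N - 1\<close> nonzero residues occur as differences, so none occurs twice.\<close>

lemma perfect_difference_setI:
  assumes N: "N = q\<^sup>2 + q + 1" and D: "D \<subseteq> {..<N}" "card D \<le> q + 1"
    and cover: "\<And>d. \<lbrakk>0 < d; d < N\<rbrakk> \<Longrightarrow> \<exists>a\<in>D. (a + d) mod N \<in> D"
  shows "perfect_difference_set N D"
proof -
  have fin: "finite D" using D(1) finite_subset by blast
  \<comment> \<open>\<open>S\<close> lists the representations; \<open>h\<close> turns each into its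
    pair of elements, injectively and off the diagonal.\<close>
  define S where "S = {(a, d). 0 < d \<and> d < N \<and> a \<in> D \<and> (a + d) mod N \<in> D}"
  define h where "h = (\<lambda>(a, d). (a, (a + d) mod N))"
  have inj: "inj_on h S"
  proof (rule inj_onI)
    fix u v assume "u \<in> S" "v \<in> S" "h u = h v"
    then show "u = v"
      using add_mod_cancel_left[of "fst u" "snd u" N "snd v"]
      by (auto simp: S_def h_def split: prod.splits)
  qed
  have img: "h ` S \<subseteq> D \<times> D - (\<lambda>a. (a, a)) ` D"
  proof (rule image_subsetI)
    fix u assume "u \<in> S"
    then obtain a d where u: "u = (a, d)" "0 < d" "d < N" "a \<in> D" "(a + d) mod N \<in> D"
      by (auto simp: S_def)
    then have "(a + d) mod N \<noteq> a"
      using add_mod_cancel_left[of a d N 0] D(1) by auto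
    then show "h u \<in> D \<times> D - (\<lambda>a. (a, a)) ` D" using u by (auto simp: h_def)
  qed
  have finS: "finite S"
    using inj img fin by (meson finite_Diff finite_SigmaI finite_imageD finite_subset)
  have "card S = card (h ` S)" using inj by (simp add: card_image)
  also have "\<dots> \<le> card (D \<times> D - (\<lambda>a. (a, a)) ` D)"
    using fin img by (intro card_mono) auto
  also have "\<dots> = card D * card D - card D"
    using fin by (subst card_Diff_subset) (auto simp: card_image inj_on_def card_cartesian_product)
  also have "\<dots> = card D * (card D - 1)" by (simp add: diff_mult_distrib2)
  also have "\<dots> \<le> (q + 1) * q" using D(2) by (intro mult_mono) auto
  finally have "card S \<le> N - 1" using N by (simp add: power2_eq_square)
  \<comment> \<open>A surjection onto \<open>N - 1\<close> residues from at most
    \<open>N - 1\<close> representations is injective.\<close>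
  moreover have "snd ` S = {0<..<N}"
  proof
    show "{0<..<N} \<subseteq> snd ` S"
    proof
      fix d assume "d \<in> {0<..<N}"
      with cover[of d] obtain a where "(a, d) \<in> S" by (auto simp: S_def)
      then show "d \<in> snd ` S" by force
    qed
  qed (auto simp: S_def)
  moreover have "card (snd ` S) \<le> card S" using finS by (rule card_image_le)
  ultimately have "inj_on snd S" using finS by (intro eq_card_imp_inj_on) auto
  then have uniq: "a = b" if "(a, d) \<in> S" "(b, d) \<in> S" for a b d
    using that by (force simp: inj_on_def)
  show ?thesis
    unfolding perfect_difference_set_def
  proof (intro conjI allI impI)
    fix d assume d: "0 < d \<and> d < N"
    then obtain a where "a \<in> D" "(a + d) mod N \<in> D" using cover by blast
    then show "\<exists>!a. a \<in> D \<and> (a + d) mod N \<in> D"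
      using uniq[of _ d] d by (intro ex1I[of _ a]) (auto simp: S_def)
  qed (fact D(1))
qed

text \<open>A generator of the cyclic multiplicative group has order
  \<open>card (carrier R) - 1\<close>, so its powers are compared modulo that number. Exponents stay
  natural, which is why the proof first takes \<open>i \<le> j\<close>.\<close>

lemma (in field) primitive_element_exists:
  assumes fin: "finite (carrier R)"
  obtains g where "g \<in> carrier R - {\<zero>}"
    and "\<And>x. x \<in> carrier R - {\<zero>} \<Longrightarrow> \<exists>i::nat. x = g [^] i"
    and "\<And>i j :: nat. g [^] i = g [^] j \<longleftrightarrow> [i = j] (mod (card (carrier R) - 1))"
proof -
  let ?M = "card (carrier R) - 1"
  interpret G: group "Multiplicative_Group.mult_of R" rewrites
      "([^]\<^bsub>Multiplicative_Group.mult_of R\<^esub>) = (([^]) :: _ \<Rightarrow> nat \<Rightarrow> _)" and "\<one>\<^bsub>Multiplicative_Group.mult_of R\<^esub> = \<one>"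
    by (rule field_mult_group) (simp_all add: fun_eq_iff nat_pow_def)
  have fin': "finite (carrier (Multiplicative_Group.mult_of R))" using fin by (rule finite_mult_of)
  obtain g where g: "g \<in> carrier (Multiplicative_Group.mult_of R)"
    and gen: "carrier (Multiplicative_Group.mult_of R) = {g [^] i | i :: nat. i \<in> UNIV}"
    using finite_field_mult_group_has_gen[OF fin] by auto
  have g': "g \<in> carrier R - {\<zero>}" using g by simp
  then have unit: "g \<in> Units R" by (simp add: field_Units)
  have "group.ord (Multiplicative_Group.mult_of R) g = card ((\<lambda>i. g [^] i) ` {0..group.ord (Multiplicative_Group.mult_of R) g - 1})"
    using G.ord_inj[OF g] G.ord_ge_1[OF fin' g] by (simp add: card_image)
  also have "(\<lambda>i. g [^] i) ` {0..group.ord (Multiplicative_Group.mult_of R) g - 1} = carrier (Multiplicative_Group.mult_of R)"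
    unfolding gen G.ord_elems[OF fin' g] by (simp only: image_def Bex_def) blast
  also have "card \<dots> = ?M" using fin by (simp add: card_Diff_singleton)
  finally have ord: "group.ord (Multiplicative_Group.mult_of R) g = ?M" .
  have one: "g [^] n = \<one> \<longleftrightarrow> ?M dvd n" for n
    using G.pow_eq_id[OF g, of n] ord by simp
  have cancel: "g [^] i = g [^] (i + d) \<longleftrightarrow> g [^] d = \<one>" for i d :: nat
  proof -
    have "g [^] (i + d) = g [^] i \<otimes> g [^] d" using g' by (simp add: nat_pow_mult)
    moreover have "g [^] i \<otimes> g [^] d = g [^] i \<otimes> \<one> \<longleftrightarrow> g [^] d = \<one>"
      using g' unit Units_pow_closed[OF unit] by (intro Units_l_cancel) auto
    ultimately show ?thesis using g' by auto
  qed
  have le: "g [^] i = g [^] j \<longleftrightarrow> [i = j] (mod ?M)" if ij: "i \<le> j" for i j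
  proof -
    obtain d where d: "j = i + d" using ij by (auto simp: le_iff_add)
    have "[i = i + d] (mod ?M) \<longleftrightarrow> [i + d = i] (mod ?M)" by (rule cong_sym_eq)
    also have "\<dots> \<longleftrightarrow> ?M dvd d" by (simp only: cong_add_lcancel_0_nat cong_0_iff)
    finally have "[i = i + d] (mod ?M) \<longleftrightarrow> ?M dvd d" .
    then show ?thesis unfolding d cancel one by simp
  qed
  show thesis
  proof (rule that[OF g'])
    show "\<exists>i::nat. x = g [^] i" if "x \<in> carrier R - {\<zero>}" for x
      using that gen by auto
    show "g [^] i = g [^] j \<longleftrightarrow> [i = j] (mod ?M)" for i j :: nat
      using le[of i j] le[of j i] cong_sym_eq[of i j ?M] by (metis nat_le_linear)
  qed
qed

text \<open>\<open>N\<close> is the index of the nonzero elements of \<open>F\<close> in those of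
  \<open>K\<close>, so residues modulo \<open>N\<close> name the one-dimensional subspaces of
  \<open>K\<close> over \<open>F\<close>, and \<open>D\<close> names those within \<open>W\<close>.
  The bound on \<open>card D\<close> later supplies a point off the line at infinity.\<close>

theorem singer_difference_set:
  assumes "primepow q"
  obtains D where "perfect_difference_set (q\<^sup>2 + q + 1) D" "card D \<le> q + 1"
proof -
  obtain p k where p: "Factorial_Ring.prime p" and k: "k > 0" and q_eq: "q = p ^ k"
    using assms by (auto simp: primepow_def)
  have q: "q \<ge> 2" using primepow_gt_Suc_0[OF assms] by simp
  obtain K :: "((int list \<times> nat) multiset \<Rightarrow> int) ring"
    where K: "field K" "card (carrier K) = p ^ (3 * k)" "[p] \<cdot>\<^bsub>K\<^esub> \<one>\<^bsub>K\<^esub> = \<zero>\<^bsub>K\<^esub>"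
    using finite_field_exists[OF p, of "3 * k"] k by auto
  interpret field K by (fact K(1))
  have cardK: "card (carrier K) = q ^ 3" using K(2) by (simp add: q_eq power_mult mult.commute flip: power_mult)
  have finK: "finite (carrier K)" using cardK q by (intro card_ge_0_finite) simp
  define N where "N = q\<^sup>2 + q + 1"
  define M where "M = q ^ 3 - 1"
  have M: "M = N * (q - 1)"
  proof -
    obtain r where "q = Suc r" using q by (cases q) auto
    then show ?thesis by (simp add: M_def N_def power2_eq_square power3_eq_cube algebra_simps)
  qed
  have N0: "N > 0" by (simp add: N_def)
  obtain g where g: "g \<in> carrier K - {\<zero>\<^bsub>K\<^esub>}"
    and gen: "\<And>x. x \<in> carrier K - {\<zero>\<^bsub>K\<^esub>} \<Longrightarrow> \<exists>i::nat. x = g [^]\<^bsub>K\<^esub> i"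
    and g_eq: "\<And>i j :: nat. g [^]\<^bsub>K\<^esub> i = g [^]\<^bsub>K\<^esub> j \<longleftrightarrow> [i = j] (mod M)"
    using primitive_element_exists[OF finK] unfolding cardK M_def by blast
  have gK [simp]: "g \<in> carrier K" "g [^]\<^bsub>K\<^esub> (i :: nat) \<in> carrier K" for i using g by auto
  have g_nz [simp]: "g [^]\<^bsub>K\<^esub> (i :: nat) \<noteq> \<zero>\<^bsub>K\<^esub>" for i
    using g by (induction i) (auto simp: integral_iff)

  \<comment> \<open>The subfield with \<open>q\<close> elements\<close>
  define F where "F = {x \<in> carrier K. x [^]\<^bsub>K\<^esub> q = x}"
  have F: "subfield F K"
    unfolding F_def q_eq by (rule subfield_frobenius_fixed[OF p K(3)])
  have FK: "x \<in> carrier K" if "x \<in> F" for x using that by (simp add: F_def)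
  note F_add = subringE(7)[OF subfieldE(1)[OF F]] and F_mult = subringE(6)[OF subfieldE(1)[OF F]]
    and F_minus = subringE(5)[OF subfieldE(1)[OF F]] and F_zero = subringE(2)[OF subfieldE(1)[OF F]]
  have g_F: "g [^]\<^bsub>K\<^esub> i \<in> F \<longleftrightarrow> N dvd i" for i :: nat
  proof -
    have "g [^]\<^bsub>K\<^esub> i \<in> F \<longleftrightarrow> [i * q = i] (mod M)"
      by (simp add: F_def nat_pow_pow g_eq)
    also have "i * q = i + i * (q - 1)" using q by (cases q) auto
    also have "[i + i * (q - 1) = i] (mod M) \<longleftrightarrow> N * (q - 1) dvd i * (q - 1)"
      using cong_add_lcancel_0_nat[of i "i * (q - 1)" M] by (simp add: cong_0_iff M)
    also have "\<dots> \<longleftrightarrow> N dvd i" using q by auto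
    finally show ?thesis .
  qed
  \<comment> \<open>The primitive element gives the size of \<open>F\<close> directly; the earlier
    root count was over an algebraically closed field, which \<open>K\<close> is not.\<close>
  have F_eq: "F = insert \<zero>\<^bsub>K\<^esub> ((\<lambda>j. g [^]\<^bsub>K\<^esub> (N * j)) ` {..<q - 1})"
  proof
    show "F \<subseteq> insert \<zero>\<^bsub>K\<^esub> ((\<lambda>j. g [^]\<^bsub>K\<^esub> (N * j)) ` {..<q - 1})"
    proof
      fix x assume x: "x \<in> F"
      show "x \<in> insert \<zero>\<^bsub>K\<^esub> ((\<lambda>j. g [^]\<^bsub>K\<^esub> (N * j)) ` {..<q - 1})"
      proof (cases "x = \<zero>\<^bsub>K\<^esub>")
        case False
        then obtain i :: nat where i: "x = g [^]\<^bsub>K\<^esub> i" using gen FK[OF x] by blast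
        then obtain j where j: "i = N * j" using x g_F by (auto elim: dvdE)
        have "x = g [^]\<^bsub>K\<^esub> (N * (j mod (q - 1)))"
          unfolding i j g_eq cong_def M mult_mod_right[symmetric] by simp
        then show ?thesis using q by auto
      qed simp
    qed
    have "g [^]\<^bsub>K\<^esub> (N * j) \<in> F" for j by (simp only: g_F dvd_triv_left)
    then show "insert \<zero>\<^bsub>K\<^esub> ((\<lambda>j. g [^]\<^bsub>K\<^esub> (N * j)) ` {..<q - 1}) \<subseteq> F" using F_zero by blast
  qed
  have inj_F: "inj_on (\<lambda>j. g [^]\<^bsub>K\<^esub> (N * j)) {..<q - 1}"
    unfolding inj_on_def g_eq cong_def M mult_mod_right[symmetric] using N0 by simp
  have cardF: "card F = q"
    unfolding F_eq using q inj_F by (subst card_insert_disjoint) (auto simp: card_image g_nz[symmetric] simp del: g_nz)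
  have finF: "finite F" unfolding F_eq by simp

  \<comment> \<open>A two-dimensional subspace over \<open>F\<close>\<close>
  obtain t where t: "t \<in> carrier K" "t \<notin> F"
  proof -
    have "card F < card (carrier K)"
      using q power_strict_increasing[of 1 3 q] by (simp add: cardF cardK)
    then show thesis using that FK finF by (metis card_mono leD subsetI)
  qed
  define w where "w = (\<lambda>(a, b). a \<oplus>\<^bsub>K\<^esub> b \<otimes>\<^bsub>K\<^esub> t)"
  define W where "W = w ` (F \<times> F)"
  have W: "x \<in> carrier K" if "x \<in> W" for x using that t FK by (auto simp: W_def w_def)
  have W_diff: "x \<ominus>\<^bsub>K\<^esub> y \<in> W" if xy: "x \<in> W" "y \<in> W" for x y
  proof -
    obtain a b c d where ab: "x = w (a, b)" "y = w (c, d)" "a \<in> F" "b \<in> F" "c \<in> F" "d \<in> F"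
      using xy by (auto simp: W_def)
    then have "x \<ominus>\<^bsub>K\<^esub> y = w (a \<ominus>\<^bsub>K\<^esub> c, b \<ominus>\<^bsub>K\<^esub> d)"
      using t FK by (simp add: w_def minus_eq l_distr minus_add a_ac l_minus)
    moreover have "a \<ominus>\<^bsub>K\<^esub> c \<in> F" "b \<ominus>\<^bsub>K\<^esub> d \<in> F" using ab F_add F_minus by (simp_all add: minus_eq)
    ultimately show ?thesis by (auto simp: W_def)
  qed
  have W_mult: "c \<otimes>\<^bsub>K\<^esub> x \<in> W" if cx: "c \<in> F" "x \<in> W" for c x
  proof -
    obtain a b where ab: "x = w (a, b)" "a \<in> F" "b \<in> F" using cx by (auto simp: W_def)
    then have "c \<otimes>\<^bsub>K\<^esub> x = w (c \<otimes>\<^bsub>K\<^esub> a, c \<otimes>\<^bsub>K\<^esub> b)"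
      using t FK cx(1) by (simp add: w_def r_distr m_assoc)
    then show ?thesis using ab F_mult cx(1) by (auto simp: W_def)
  qed
  have inj_w: "inj_on w (F \<times> F)"
  proof -
    have "a = c \<and> b = d"
      if F4: "a \<in> F" "b \<in> F" "c \<in> F" "d \<in> F" and eq: "w (a, b) = w (c, d)" for a b c d
    proof -
      note [simp] = FK[OF F4(1)] FK[OF F4(2)] FK[OF F4(3)] FK[OF F4(4)] t(1)
      have *: "a \<ominus>\<^bsub>K\<^esub> c = (d \<ominus>\<^bsub>K\<^esub> b) \<otimes>\<^bsub>K\<^esub> t"
      proof -
        have "a \<ominus>\<^bsub>K\<^esub> c = w (a, b) \<ominus>\<^bsub>K\<^esub> c \<ominus>\<^bsub>K\<^esub> b \<otimes>\<^bsub>K\<^esub> t"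
          by (simp add: w_def minus_eq a_ac r_neg r_neg2 r_neg1)
        also have "\<dots> = (d \<ominus>\<^bsub>K\<^esub> b) \<otimes>\<^bsub>K\<^esub> t"
          unfolding eq by (simp add: w_def minus_eq l_distr l_minus a_ac r_neg r_neg2 r_neg1)
        finally show ?thesis .
      qed
      \<comment> \<open>Linear independence of 1 and \<open>t\<close>: a nonzero difference could be
        inverted in \<open>F\<close>, putting \<open>t\<close> into \<open>F\<close>.\<close>
      have "d \<ominus>\<^bsub>K\<^esub> b = \<zero>\<^bsub>K\<^esub>"
      proof (rule ccontr)
        assume nz: "d \<ominus>\<^bsub>K\<^esub> b \<noteq> \<zero>\<^bsub>K\<^esub>"
        have mem: "d \<ominus>\<^bsub>K\<^esub> b \<in> F" "a \<ominus>\<^bsub>K\<^esub> c \<in> F"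
          using F4 F_add F_minus by (simp_all add: minus_eq)
        then have inv: "inv\<^bsub>K\<^esub> (d \<ominus>\<^bsub>K\<^esub> b) \<in> F"
          using subfield_m_inv(1)[OF F] nz by simp
        have unit: "d \<ominus>\<^bsub>K\<^esub> b \<in> Units K" using nz by (simp add: field_Units)
        have "t = inv\<^bsub>K\<^esub> (d \<ominus>\<^bsub>K\<^esub> b) \<otimes>\<^bsub>K\<^esub> (a \<ominus>\<^bsub>K\<^esub> c)"
          unfolding * using unit by (simp add: m_assoc[symmetric])
        then show False using t(2) F_mult[OF inv mem(2)] by simp
      qed
      moreover from this have "a \<ominus>\<^bsub>K\<^esub> c = \<zero>\<^bsub>K\<^esub>" using * t(1) by (metis l_null)
      ultimately show ?thesis by (simp add: r_right_minus_eq)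
    qed
    then show ?thesis by (auto simp: inj_on_def)
  qed
  have cardW: "card W = q\<^sup>2"
    unfolding W_def using inj_w by (simp add: card_image card_cartesian_product cardF power2_eq_square)
  have finW: "finite W" unfolding W_def using finF by simp
  have zeroW: "\<zero>\<^bsub>K\<^esub> \<in> W"
    using F_zero t by (auto simp: W_def w_def image_iff intro!: bexI[of _ "\<zero>\<^bsub>K\<^esub>"])

  \<comment> \<open>The difference set of exponents\<close>
  define D where "D = {i. i < N \<and> g [^]\<^bsub>K\<^esub> i \<in> W}"
  \<comment> \<open>Factors \<open>g^(N * j)\<close> lie in \<open>F\<close> and preserve
    \<open>W\<close>, so membership depends only on the exponent modulo \<open>N\<close>.\<close>
  have g_W: "g [^]\<^bsub>K\<^esub> i \<in> W \<longleftrightarrow> i mod N \<in> D" for i :: nat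
  proof -
    have W_shift: "g [^]\<^bsub>K\<^esub> (i + N * j) \<in> W" if "g [^]\<^bsub>K\<^esub> i \<in> W" for i j :: nat
      using W_mult[of "g [^]\<^bsub>K\<^esub> (N * j)"] that g_F
        m_comm[of "g [^]\<^bsub>K\<^esub> i" "g [^]\<^bsub>K\<^esub> (N * j)"] by (simp flip: nat_pow_mult)
    have "g [^]\<^bsub>K\<^esub> (i mod N) \<in> W" if "g [^]\<^bsub>K\<^esub> i \<in> W"
    proof -
      \<comment> \<open>Division by \<open>g [^] (N * (i div N))\<close>, written with a natural exponent.\<close>
      have "i + N * (i div N * (q - 2)) = i mod N + M * (i div N)"
      proof -
        obtain r where r: "q = Suc (Suc r)" using q by (metis Suc_le_D numeral_2_eq_2 Suc_le_mono)
        have "i = i mod N + N * (i div N)" by simp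
        then show ?thesis unfolding M r by (simp add: algebra_simps)
      qed
      then have "g [^]\<^bsub>K\<^esub> (i mod N) = g [^]\<^bsub>K\<^esub> (i + N * (i div N * (q - 2)))"
        by (simp add: g_eq cong_def)
      then show ?thesis using W_shift[OF that] by simp
    qed
    moreover have "g [^]\<^bsub>K\<^esub> i \<in> W" if "g [^]\<^bsub>K\<^esub> (i mod N) \<in> W"
      using W_shift[OF that, of "i div N"] by simp
    ultimately show ?thesis using N0 by (auto simp: D_def)
  qed
  have D: "D \<subseteq> {..<N}" by (auto simp: D_def)
  have cardD: "card D \<le> q + 1"
  proof -
    \<comment> \<open>Each \<open>i\<close> in \<open>D\<close> accounts for \<open>q - 1\<close>
      nonzero elements of \<open>W\<close>, the multiples of \<open>g^i\<close> by nonzero elements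
      of \<open>F\<close>; exponents below \<open>M\<close> keep them all distinct.\<close>
    let ?h = "\<lambda>(i, j). g [^]\<^bsub>K\<^esub> (i + N * j)"
    have lt: "i + N * j < M" if "i < N" "j < q - 1" for i j
    proof -
      have "i + N * j < N * Suc j" using that by simp
      also have "\<dots> \<le> M" unfolding M using that by (intro mult_le_mono2) simp
      finally show ?thesis .
    qed
    have "inj_on ?h (D \<times> {..<q - 1})"
    proof (rule inj_onI, clarify)
      fix i j i' j'
      assume a: "i \<in> D" "i' \<in> D" "j < q - 1" "j' < q - 1"
        "g [^]\<^bsub>K\<^esub> (i + N * j) = g [^]\<^bsub>K\<^esub> (i' + N * j')"
      then have "i + N * j = i' + N * j'"
        using lt[of i j] lt[of i' j'] by (simp add: g_eq cong_def D_def)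
      then have "(i + N * j) mod N = (i' + N * j') mod N" "(i + N * j) div N = (i' + N * j') div N"
        by simp_all
      then show "i = i' \<and> j = j'" using a D by (auto simp: D_def)
    qed
    moreover have "g [^]\<^bsub>K\<^esub> (i + N * j) \<in> W" if "i \<in> D" for i j
      using that D by (auto simp: g_W)
    then have "?h ` (D \<times> {..<q - 1}) \<subseteq> W - {\<zero>\<^bsub>K\<^esub>}" by auto
    ultimately have "card (D \<times> {..<q - 1}) \<le> card (W - {\<zero>\<^bsub>K\<^esub>})"
      using finW by (intro card_inj_on_le[of ?h]) auto
    also have "\<dots> = q\<^sup>2 - 1" using zeroW finW by (simp add: cardW)
    also have "\<dots> = (q + 1) * (q - 1)" by (simp add: power2_eq_square algebra_simps)
    finally have "card D * (q - 1) \<le> (q + 1) * (q - 1)" by (simp only: card_cartesian_product card_lessThan)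
    moreover have "q - 1 > 0" using q by simp
    ultimately show ?thesis using mult_le_cancel2 by blast
  qed
  have cover: "\<exists>a\<in>D. (a + d) mod N \<in> D" for d
  proof -
    let ?h = "\<lambda>(x, y). x \<ominus>\<^bsub>K\<^esub> g [^]\<^bsub>K\<^esub> d \<otimes>\<^bsub>K\<^esub> y"
    have "card (?h ` (W \<times> W)) \<le> card (carrier K)"
      using finK W by (intro card_mono) auto
    also have "\<dots> < card (W \<times> W)"
      using q power_strict_increasing[of 3 4 q] by (simp add: cardK cardW card_cartesian_product flip: power_add)
    finally have "\<not> inj_on ?h (W \<times> W)" by (rule pigeonhole)
    then obtain x y x' y' where xy: "x \<in> W" "y \<in> W" "x' \<in> W" "y' \<in> W" "(x, y) \<noteq> (x', y')"
      and eq: "x \<ominus>\<^bsub>K\<^esub> g [^]\<^bsub>K\<^esub> d \<otimes>\<^bsub>K\<^esub> y = x' \<ominus>\<^bsub>K\<^esub> g [^]\<^bsub>K\<^esub> d \<otimes>\<^bsub>K\<^esub> y'"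
      unfolding inj_on_def by auto
    note [simp] = W[OF xy(1)] W[OF xy(2)] W[OF xy(3)] W[OF xy(4)]
    \<comment> \<open>The collision reads \<open>g^d v = x - x'\<close>. A zero \<open>v\<close>
      would make it trivial; otherwise \<open>v = g^i\<close>, and both \<open>g^i\<close> and
      \<open>g^(i + d)\<close> lie in \<open>W\<close>.\<close>
    define v where "v = y \<ominus>\<^bsub>K\<^esub> y'"
    have v: "v \<in> W" "v \<in> carrier K" using W_diff xy by (simp_all add: v_def)
    have gv: "g [^]\<^bsub>K\<^esub> d \<otimes>\<^bsub>K\<^esub> v = x \<ominus>\<^bsub>K\<^esub> x'"
    proof -
      let ?u = "g [^]\<^bsub>K\<^esub> d \<otimes>\<^bsub>K\<^esub> y" and ?u' = "g [^]\<^bsub>K\<^esub> d \<otimes>\<^bsub>K\<^esub> y'"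
      have "x \<ominus>\<^bsub>K\<^esub> x' = (x \<ominus>\<^bsub>K\<^esub> ?u) \<oplus>\<^bsub>K\<^esub> ?u \<ominus>\<^bsub>K\<^esub> x'"
        by (simp add: minus_eq a_assoc l_neg)
      also have "\<dots> = ?u \<ominus>\<^bsub>K\<^esub> ?u'"
        unfolding eq by (simp add: minus_eq a_ac r_neg r_neg2 r_neg1)
      also have "\<dots> = g [^]\<^bsub>K\<^esub> d \<otimes>\<^bsub>K\<^esub> v" by (simp add: v_def minus_eq r_distr r_minus)
      finally show ?thesis by simp
    qed
    have "v \<noteq> \<zero>\<^bsub>K\<^esub>"
    proof
      assume "v = \<zero>\<^bsub>K\<^esub>"
      moreover from this have "x \<ominus>\<^bsub>K\<^esub> x' = \<zero>\<^bsub>K\<^esub>" using gv by simp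
      ultimately have "y = y'" "x = x'" by (simp_all add: v_def r_right_minus_eq)
      then show False using xy(5) by simp
    qed
    then obtain i :: nat where i: "v = g [^]\<^bsub>K\<^esub> i" using gen v by blast
    have "g [^]\<^bsub>K\<^esub> (i + d) \<in> W"
      using gv W_diff[OF xy(1,3)] i by (simp add: add.commute flip: nat_pow_mult)
    then have "(i + d) mod N \<in> D" "i mod N \<in> D" using v i by (simp_all add: g_W[symmetric])
    then show ?thesis by (intro bexI[of _ "i mod N"]) (simp_all add: mod_simps)
  qed
  show thesis
    using that perfect_difference_setI[OF N_def D cardD cover] cardD by (simp add: N_def)
qed

section \<open>Projective planes\<close>

text \<open>Both conditions together say that \<open>(i + j) mod N\<close> represents the difference
  of \<open>i'\<close> and \<open>i\<close>, which fixes \<open>j\<close>. As incidence depends on a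
  sum, this serves for lines through two points and for points on two lines.\<close>

lemma perfect_difference_set_join:
  assumes D: "perfect_difference_set N D" and i: "i < N" "i' < N" "i \<noteq> i'"
  shows "\<exists>!j. j < N \<and> (i + j) mod N \<in> D \<and> (i' + j) mod N \<in> D"
proof -
  have main: "\<exists>!j. j < N \<and> (i + j) mod N \<in> D \<and> (i' + j) mod N \<in> D"
    if i: "i < i'" "i' < N" for i i'
  proof -
    define d where "d = i' - i"
    have d: "0 < d" "d < N" "i' = i + d" using i by (auto simp: d_def)
    obtain a where a: "a \<in> D" "(a + d) mod N \<in> D"
      and uniq: "\<And>b. \<lbrakk>b \<in> D; (b + d) mod N \<in> D\<rbrakk> \<Longrightarrow> b = a"
      using D d unfolding perfect_difference_set_def by blast
    have aN: "a < N" using D a by (auto simp: perfect_difference_set_def)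
    \<comment> \<open>This is \<open>a - i\<close> modulo \<open>N\<close>, with
      \<open>N - i\<close> in place of a negative number.\<close>
    define j where "j = (a + (N - i)) mod N"
    have ij: "(i + j) mod N = a"
    proof -
      have "(i + j) mod N = (i + (a + (N - i))) mod N" by (simp add: j_def mod_simps)
      also have "i + (a + (N - i)) = a + N" using i by simp
      finally show ?thesis using aN by simp
    qed
    have shift: "(i' + x) mod N = ((i + x) mod N + d) mod N" for x
      by (simp add: d mod_simps ac_simps)
    show ?thesis
    proof (intro ex1I conjI)
      show "j < N" using i by (simp add: j_def)
      show "(i + j) mod N \<in> D" "(i' + j) mod N \<in> D" using a by (simp_all add: shift ij)
      fix x assume x: "x < N \<and> (i + x) mod N \<in> D \<and> (i' + x) mod N \<in> D"
      then have "(i + x) mod N = a" using uniq by (simp add: shift)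
      then have "(i + x) mod N = (i + j) mod N" using ij by simp
      then show "x = j" using x \<open>j < N\<close> add_mod_cancel_left by blast
    qed
  qed
  show ?thesis
  proof (cases "i < i'")
    case True
    then show ?thesis using main i by blast
  next
    case False
    then have "i' < i" using i by simp
    from main[OF this i(1)] show ?thesis by (simp add: conj_commute)
  qed
qed

text \<open>Points and lines share a type, and are assumed disjoint, because both become vertices of
  one graph.\<close>

locale projective_plane_with_infinity =
  fixes P L :: "'a set" and I :: "'a \<Rightarrow> 'a \<Rightarrow> bool" and infty :: 'a
  assumes finite: "finite P" "finite L"
    and disjoint: "P \<inter> L = {}"
    and infty: "infty \<in> L"
    and join: "\<lbrakk>x \<in> P; y \<in> P; x \<noteq> y\<rbrakk> \<Longrightarrow> \<exists>!l. l \<in> L \<and> I x l \<and> I y l"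
    and meet: "\<lbrakk>l \<in> L; m \<in> L; l \<noteq> m\<rbrakk> \<Longrightarrow> \<exists>!x. x \<in> P \<and> I x l \<and> I x m"
begin

abbreviation V :: "'a set" where "V \<equiv> P \<union> (L - {infty})"

text \<open>In affine terms, every class of parallel lines becomes a clique, and so does the set of
  ideal points.\<close>

definition adj :: "'a \<Rightarrow> 'a \<Rightarrow> bool" where
  "adj u v \<longleftrightarrow>
     u \<in> P \<and> v \<in> L - {infty} \<and> I u v \<or>
     v \<in> P \<and> u \<in> L - {infty} \<and> I v u \<or>
     u \<in> P \<and> v \<in> P \<and> u \<noteq> v \<and> I u infty \<and> I v infty \<or>
     u \<in> L - {infty} \<and> v \<in> L - {infty} \<and> u \<noteq> v \<and> (\<exists>x\<in>P. I x infty \<and> I x u \<and> I x v)"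

definition G :: "'a pair_pre_digraph" where
  "G = \<lparr>pverts = V, parcs = {(u, v). adj u v}\<rparr>"

lemma adj_sym: "adj u v \<Longrightarrow> adj v u"
  unfolding adj_def by blast

lemma adj_irrefl: "\<not> adj u u"
  using disjoint unfolding adj_def by blast

lemma adj_in_V: "adj u v \<Longrightarrow> u \<in> V \<and> v \<in> V"
  unfolding adj_def by blast

lemma join_unique: "\<lbrakk>x \<in> P; y \<in> P; x \<noteq> y; l \<in> L; I x l; I y l; m \<in> L; I x m; I y m\<rbrakk> \<Longrightarrow> l = m"
  using join by blast

lemma adj_PL: "\<lbrakk>u \<in> P; v \<in> L\<rbrakk> \<Longrightarrow> adj u v \<longleftrightarrow> v \<noteq> infty \<and> I u v"
  using disjoint unfolding adj_def by blast

lemma adj_LP: "\<lbrakk>u \<in> L; v \<in> P\<rbrakk> \<Longrightarrow> adj u v \<longleftrightarrow> u \<noteq> infty \<and> I v u"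
  using disjoint unfolding adj_def by blast

lemma adj_PP: "\<lbrakk>u \<in> P; v \<in> P\<rbrakk> \<Longrightarrow> adj u v \<longleftrightarrow> u \<noteq> v \<and> I u infty \<and> I v infty"
  using disjoint unfolding adj_def by blast

lemma adj_LL: "\<lbrakk>u \<in> L; v \<in> L\<rbrakk> \<Longrightarrow> adj u v \<longleftrightarrow>
    u \<noteq> infty \<and> v \<noteq> infty \<and> u \<noteq> v \<and> (\<exists>x\<in>P. I x infty \<and> I x u \<and> I x v)"
  using disjoint by (auto simp: adj_def)

lemma pair_graph_G: "pair_graph G"
proof
  show "finite (parcs G)"
    by (rule finite_subset[of _ "V \<times> V"]) (use finite adj_in_V in \<open>auto simp: G_def\<close>)
  show "symmetric (with_proj G)"
    by (auto simp: symmetric_def G_def sym_def intro: adj_sym)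
qed (use finite adj_irrefl in \<open>auto simp: G_def dest: adj_in_V\<close>)

text \<open>The joining line is not \<open>infty\<close>, else \<open>u\<close> and \<open>v\<close>
  would be adjacent. A point adjacent to both would make both ideal, with the same
  contradiction.\<close>

lemma common_neighbour_points:
  assumes u: "u \<in> P" and v: "v \<in> P" and uv: "u \<noteq> v" "\<not> adj u v"
  shows "\<exists>!w. adj u w \<and> adj w v"
proof -
  obtain l where l: "l \<in> L" "I u l" "I v l" using join u v uv by blast
  have "l \<noteq> infty" using l u v uv by (auto simp: adj_PP)
  show ?thesis
  proof (rule ex1I[of _ l])
    show "adj u l \<and> adj l v" using l \<open>l \<noteq> infty\<close> u v by (simp add: adj_PL adj_LP)
    fix w assume w: "adj u w \<and> adj w v"
    show "w = l"
    proof (cases "w \<in> P")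
      case True
      then show ?thesis using w u v uv by (auto simp: adj_PP)
    next
      case False
      then have "w \<in> L" using w adj_in_V by blast
      with w u v have "I u w" "I v w" by (simp_all add: adj_PL adj_LP)
      then show ?thesis using join_unique[OF u v uv(1)] l \<open>w \<in> L\<close> by blast
    qed
  qed
qed

text \<open>The meeting point is not ideal, else the lines would be adjacent. A line adjacent to
  both would meet them in ideal points; having only one ideal point itself, it would make the
  meeting point ideal.\<close>

lemma common_neighbour_lines:
  assumes u: "u \<in> L" "u \<noteq> infty" and v: "v \<in> L" "v \<noteq> infty" and uv: "u \<noteq> v" "\<not> adj u v"
  shows "\<exists>!w. adj u w \<and> adj w v"
proof -
  obtain x where x: "x \<in> P" "I x u" "I x v" using meet u v uv by blast
  have x_inf: "\<not> I x infty" using x u v uv by (auto simp: adj_LL)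
  show ?thesis
  proof (rule ex1I[of _ x])
    show "adj u x \<and> adj x v" using x u v by (simp add: adj_PL adj_LP)
    fix w assume w: "adj u w \<and> adj w v"
    show "w = x"
    proof (cases "w \<in> P")
      case True
      then have "I w u" "I w v" using w u v by (auto simp: adj_PL adj_LP)
      then show ?thesis using True x u v uv join_unique by blast
    next
      case False
      then have wL: "w \<in> L" using w adj_in_V by blast
      then obtain y z where y: "y \<in> P" "I y infty" "I y u" "I y w"
        and z: "z \<in> P" "I z infty" "I z w" "I z v" and "w \<noteq> infty"
        using w u v by (auto simp: adj_LL)
      then have "y = z" using join_unique[of y z w infty] wL infty by blast
      then have "y = x" using join_unique[of x y u v] x u v uv y z by blast
      then show ?thesis using y x_inf by blast
    qed
  qed
qed

text \<open>With \<open>c\<close> the ideal point of \<open>v\<close>, the neighbour is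
  \<open>c\<close> if \<open>u\<close> is ideal, and otherwise the line joining \<open>u\<close> and
  \<open>c\<close>, the parallel to \<open>v\<close> through \<open>u\<close>.\<close>

lemma common_neighbour_point_line:
  assumes u: "u \<in> P" and v: "v \<in> L" "v \<noteq> infty" and uv: "\<not> adj u v"
  shows "\<exists>!w. adj u w \<and> adj w v"
proof -
  have Iuv: "\<not> I u v" using uv u v by (simp add: adj_PL)
  obtain c where c: "c \<in> P" "I c v" "I c infty" using meet[OF v(1) infty v(2)] by blast
  have c_unique: "x = c" if "x \<in> P" "I x v" "I x infty" for x
    using that c v infty join_unique by blast
  have uc: "u \<noteq> c" using c Iuv by blast
  show ?thesis
  proof (cases "I u infty")
    case True
    show ?thesis
    proof (rule ex1I[of _ c])
      show "adj u c \<and> adj c v" using u v c uc True by (simp add: adj_PP adj_PL)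
      fix w assume w: "adj u w \<and> adj w v"
      show "w = c"
      proof (cases "w \<in> P")
        case True
        then show ?thesis using w u v c_unique by (auto simp: adj_PP adj_PL)
      next
        case False
        then have wL: "w \<in> L" using w adj_in_V by blast
        then obtain x where x: "x \<in> P" "I x infty" "I x w" "I x v" and "w \<noteq> infty" "I u w"
          using w u v by (auto simp: adj_PL adj_LL)
        then have "x = u" using join_unique[of x u w infty] wL infty u True by blast
        then show ?thesis using x Iuv by blast
      qed
    qed
  next
    case False
    obtain l where l: "l \<in> L" "I u l" "I c l" using join u c uc by blast
    have l_inf: "l \<noteq> infty" using l False by blast
    have "l \<noteq> v" using l Iuv by blast
    show ?thesis
    proof (rule ex1I[of _ l])
      show "adj u l \<and> adj l v"
        using u v l c l_inf \<open>l \<noteq> v\<close> by (auto simp: adj_PL adj_LL)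
      fix w assume w: "adj u w \<and> adj w v"
      show "w = l"
      proof (cases "w \<in> P")
        case True
        then show ?thesis using w u False by (auto simp: adj_PP)
      next
        case False
        then have wL: "w \<in> L" using w adj_in_V by blast
        then obtain x where x: "x \<in> P" "I x infty" "I x w" "I x v" and "I u w"
          using w u v by (auto simp: adj_PL adj_LL)
        then have "x = c" using c_unique by blast
        then show ?thesis using x \<open>I u w\<close> join_unique[of u c w l] u c uc l wL by blast
      qed
    qed
  qed
qed

lemma common_neighbour:
  assumes "u \<in> V" "v \<in> V" "u \<noteq> v" "\<not> adj u v"
  shows "\<exists>!w. adj u w \<and> adj w v"
proof -
  have sym: "adj x y \<longleftrightarrow> adj y x" for x y using adj_sym by blast
  consider "u \<in> P" "v \<in> P" | "u \<in> P" "v \<in> L" "v \<noteq> infty" | "u \<in> L" "u \<noteq> infty" "v \<in> P"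
    | "u \<in> L" "u \<noteq> infty" "v \<in> L" "v \<noteq> infty" using assms by blast
  then show ?thesis
  proof cases
    case 3
    have "\<not> adj v u" using assms(4) sym by blast
    from common_neighbour_point_line[OF 3(3,1,2) this]
    show ?thesis unfolding sym[of v] sym[of _ u] by (simp add: conj_commute)
  qed (simp_all add: assms common_neighbour_points common_neighbour_point_line common_neighbour_lines)
qed

lemma geodetic_G: "geodetic (with_proj G)"
  by (rule geodetic_if_unique_common_neighbour[OF pair_graph_G])
    (simp add: G_def common_neighbour)

text \<open>A point off \<open>infty\<close> is adjacent to no other point, which supplies the
  non-adjacent pair.\<close>

lemma diameter_G:
  assumes "x \<in> P" "\<not> I x infty" "y \<in> P" "x \<noteq> y"
  shows "diameter (with_proj G) = 2"
  by (rule diameter_eq_2[OF pair_graph_G, of x y])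
    (use assms in \<open>simp_all add: G_def adj_PP ex1_implies_ex[OF common_neighbour]\<close>)

end

section \<open>The cyclic plane and its Hamiltonian cycle\<close>

theorem theorem4:
  fixes n :: nat
  assumes "primepow n"
  shows "\<exists>G :: nat pair_pre_digraph.
           pair_graph G \<and> geodetic (with_proj G) \<and> hamiltonian (with_proj G) \<and>
           diameter (with_proj G) = 2 \<and> card (pverts G) = 2 * n^2 + 2 * n + 1"
proof -
  have n: "n \<ge> 2" using primepow_gt_Suc_0[OF assms] by simp
  define N where "N = n\<^sup>2 + n + 1"
  have N: "N > 3" using n power_mono[OF n, of 2] by (simp add: N_def)
  obtain D where D: "perfect_difference_set N D" "card D \<le> n + 1"
    using singer_difference_set[OF assms] unfolding N_def by blast
  have DN: "D \<subseteq> {..<N}" using D by (simp add: perfect_difference_set_def)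
  define I where "I i l \<longleftrightarrow> (i + l) mod N \<in> D" for i l
  \<comment> \<open>The line \<open>l\<close> is number \<open>l - N\<close>; the offset keeps points and lines apart and vanishes modulo \<open>N\<close>.\<close>
  interpret projective_plane_with_infinity "{..<N}" "{N..<2 * N}" I N
  proof
    have lines: "\<exists>!l. l \<in> {N..<2 * N} \<and> P (l mod N)" if ex: "\<exists>!j. j < N \<and> P j" for P
    proof -
      obtain j where j: "j < N" "P j" and uniq: "\<And>x. \<lbrakk>x < N; P x\<rbrakk> \<Longrightarrow> x = j" using ex by blast
      show ?thesis
      proof (rule ex1I[of _ "N + j"])
        fix l assume l: "l \<in> {N..<2 * N} \<and> P (l mod N)"
        then have "l mod N = l - N" using N by (auto simp: mod_if)
        then show "l = N + j" using l uniq[of "l - N"] by auto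
      qed (use j in auto)
    qed
    show "\<exists>!l. l \<in> {N..<2 * N} \<and> I x l \<and> I y l" if "x \<in> {..<N}" "y \<in> {..<N}" "x \<noteq> y" for x y
      using lines[OF perfect_difference_set_join[OF D(1), of x y]] that
      by (simp add: I_def mod_simps)
    show "\<exists>!x. x \<in> {..<N} \<and> I x l \<and> I x m"
      if lm: "l \<in> {N..<2 * N}" "m \<in> {N..<2 * N}" "l \<noteq> m" for l m
    proof -
      have eq: "l mod N = l - N" "m mod N = m - N" using lm by (auto simp: mod_if)
      \<comment> \<open>Exchanging the summands puts the residues of the lines in the role of
        points, so the join lemma yields the meet.\<close>
      have "(x + l) mod N = (l - N + x) mod N" "(x + m) mod N = (m - N + x) mod N" for x
        using mod_add_right_eq[of x l N] mod_add_right_eq[of x m N] eq by (simp_all add: add.commute)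
      moreover have "l - N < N" "m - N < N" "l - N \<noteq> m - N" using lm by auto
      note perfect_difference_set_join[OF D(1) this]
      ultimately show ?thesis by (simp add: I_def)
    qed
  qed (use N in auto)
  have arcs: "(u, v) \<in> parcs G \<longleftrightarrow> adj u v" and verts: "pverts G = V" for u v
    by (simp_all add: G_def)
  have V: "V = {..<N} \<union> {N<..<2 * N}" by auto
  have cardV: "card V = 2 * N - 1" using N unfolding V by (subst card_Un_disjoint) auto
  have dia: "diameter (with_proj G) = 2"
  proof -
    \<comment> \<open>Some \<open>x\<close> lies outside \<open>D\<close>; since the line
      \<open>N\<close> is 0 modulo \<open>N\<close>, the point \<open>x\<close> is off the line at
      infinity.\<close>
    have "card D < N" using D(2) n power_mono[OF n, of 2] by (simp add: N_def)
    then obtain x where x: "x < N" "x \<notin> D" using DN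
      by (metis card_lessThan lessThan_iff less_irrefl subsetI subset_antisym)
    obtain y where y: "y < N" "y \<noteq> x"
      by (rule that[of "if x = 0 then 1 else 0"]) (use N in auto)
    show ?thesis by (rule diameter_G[of x y]) (use x y in \<open>auto simp: I_def\<close>)
  qed

  have ham: "hamiltonian (with_proj G)"
  proof -
    obtain d where d: "d \<in> D" "(d + 1) mod N \<in> D"
    proof -
      have "0 < (1 :: nat) \<and> 1 < N" using N by simp
      then show thesis using D(1) that unfolding perfect_difference_set_def by blast
    qed
    have dN: "d < N" using d DN by auto
    \<comment> \<open>Point \<open>i\<close> and point \<open>i + 1\<close> both lie on line number \<open>d - i\<close>. Starting after line number \<open>0\<close>,
      the line at infinity, the path ends at \<open>d\<close> and is closed through the edge of ideal points.\<close>
    define f where "f k = (if even k then (d + 1 + k div 2) mod N else 2 * N - 1 - k div 2)" for k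
    have fV: "f k \<in> V" if "k < 2 * N - 1" for k
      using that N by (auto simp: f_def V elim!: oddE)
    have f_even: "f k < N" if "even k" for k using that N by (simp add: f_def)
    \<comment> \<open>The value \<open>N\<close>, the line at infinity, would first occur at
      \<open>k = 2 * N - 1\<close>, just beyond the range.\<close>
    have f_odd: "f k > N" if "odd k" "k < 2 * N - 1" for k using that N by (auto simp: f_def elim!: oddE)
    have inj: "inj_on f {..<2 * N - 1}"
    proof (rule inj_onI)
      fix k l assume kl: "k \<in> {..<2 * N - 1}" "l \<in> {..<2 * N - 1}" "f k = f l"
      have parity: "even k \<longleftrightarrow> even l"
        using kl f_even[of k] f_even[of l] f_odd[of k] f_odd[of l] by fastforce
      have "k div 2 = l div 2"
      proof (cases "even k")
        case True
        then have "(d + 1 + k div 2) mod N = (d + 1 + l div 2) mod N"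
          using kl parity by (simp add: f_def)
        then show ?thesis by (rule add_mod_cancel_left) (use kl in auto)
      next
        case False
        then show ?thesis using kl parity by (auto simp: f_def elim!: oddE)
      qed
      then show "k = l" using parity by (metis dvd_mult_div_cancel odd_two_times_div_two_succ)
    qed
    have img: "f ` {..<2 * N - 1} = V"
    proof (rule card_subset_eq)
      show "f ` {..<2 * N - 1} \<subseteq> V" using fV by blast
      show "card (f ` {..<2 * N - 1}) = card V" by (simp only: card_image[OF inj] cardV card_lessThan)
    qed (use finite in blast)
    show ?thesis
    proof (rule hamiltonian_if_cyclic_enumeration[OF pair_graph_G _ inj])
      show "3 \<le> 2 * N - 1" using N by simp
      show "f ` {..<2 * N - 1} = pverts G" using img verts by simp
      show "(f k, f (Suc k)) \<in> parcs G" if k: "Suc k < 2 * N - 1" for k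
      proof (cases "even k")
        case True
        then obtain m where m: "k = 2 * m" by (rule evenE)
        have fk: "f k = (d + 1 + m) mod N" "f (Suc k) = 2 * N - 1 - m" by (simp_all add: f_def m)
        \<comment> \<open>Point and line numbers sum to \<open>d\<close> modulo \<open>N\<close> for
          even \<open>k\<close> and to \<open>d + 1\<close> for odd \<open>k\<close>, and both
          residues are in \<open>D\<close>.\<close>
        have "(f k + f (Suc k)) mod N = (d + 1 + m + (2 * N - 1 - m)) mod N"
          unfolding fk by (rule mod_add_left_eq)
        also have "d + 1 + m + (2 * N - 1 - m) = d + 2 * N" using k m by simp
        finally have "(f k + f (Suc k)) mod N = d" using dN by simp
        then show ?thesis
          using k m d fk N by (simp add: arcs adj_PL I_def)
      next
        case False
        then obtain m where m: "k = 2 * m + 1" by (rule oddE)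
        have fk: "f k = 2 * N - 1 - m" "f (Suc k) = (d + 2 + m) mod N" by (simp_all add: f_def m)
        have "(f (Suc k) + f k) mod N = (d + 2 + m + (2 * N - 1 - m)) mod N"
          unfolding fk by (rule mod_add_left_eq)
        also have "d + 2 + m + (2 * N - 1 - m) = d + 1 + 2 * N" using k m by simp
        finally have "(f (Suc k) + f k) mod N = (d + 1) mod N" by simp
        then show ?thesis
          using k m d fk N by (simp add: arcs adj_LP I_def)
      qed
      have "(2 * N - 1 - 1) div 2 = N - 1" "even (2 * N - 1 - 1)" using N by auto
      then have last: "f (2 * N - 1 - 1) = d" using N dN by (simp add: f_def)
      have first: "f 0 = (d + 1) mod N" by (simp add: f_def)
      have "(d + 1) mod N \<noteq> d" using add_mod_cancel_left[of d 1 N 0] dN N by auto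
      then show "(f (2 * N - 1 - 1), f 0) \<in> parcs G"
        using d dN N unfolding last first by (simp add: arcs adj_PP I_def)
    qed
  qed
  have "card (pverts G) = 2 * n^2 + 2 * n + 1" unfolding verts cardV by (simp add: N_def)
  then show ?thesis using pair_graph_G geodetic_G dia ham by blast
qed

end
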